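(* A non-negative integer-valued random variable $X$ is positive discrete stable (in the first sense) with $\mathcal{G}$ thinning operator if and only if the probability generating function $\mathcal{Q}$ of the thinning variables takes the form $$\mathcal{Q}(z)=\left(\frac{(1-p)+(p-\kappa)z^m}{(1-p\kappa)-\kappa(1-p)z^m}\right)^{1/m},\qquad \{0\le\kappa<1,\ 0<p<1,\ m=1\}\ \text{ or }\ \{0<p<\kappa<1,\ m\in\mathbb{N},\ m>1\},$$ and the probability generating function $\mathcal{P}(z)=\mathrm{E}\,z^X$ is given as $$\mathcal{P}(z)=\exp\left\{-\lambda\left(\frac{1-z^m}{1-\kappa z^m}\right)^{\gamma}\right\}\quad\text{with}\quad \gamma\in(0,1],\ \lambda>0,\ \kappa\in[0,1),\ m\in\mathbb{N}.$$
   Context: A non-negative integer-valued random variable $X$ is called positive discrete stable in the first sense if for every integer $n\ge 2$ there exists a constant $p_n\in(0,1)$ such that $$X\stackrel{d}{=}\sum_{j=1}^{n}\tilde X_j,\qquad \tilde X_j=\sum_{i=1}^{X_j}\varepsilon_i^{(j)}(p_n),$$ where $X_1,X_2,\dots$ are independent copies of $X$ and the thinning variables $\varepsilon_i^{(j)}(p_n)$ are i.i.d. non-negative integer-valued random variables, independent of $X_1,X_2,\dots$. Their probability generating function is denoted $\mathcal{Q}(z)=\mathcal{Q}_{p_n}(z)=\mathrm{E}\,z^{\varepsilon(p_n)}$; the parameter $p=p_n$ depends on $n$. In terms of generating functions the condition is $\mathcal{P}(z)=\mathcal{P}^n(\mathcal{Q}_{p_n}(z))$. "With $\mathcal{G}$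 thinning operator" means that the thinning variables come from the modified geometric distribution $\mathcal{G}(p,\kappa,m)$ with $p=p_n$, that is, the distribution on $\mathbb{N}_0=\{0,1,2,\dots\}$ whose probability generating function is the function $\mathcal{Q}$ displayed in the claim, with the parameter ranges displayed there.
   Formalization: X is assumed not almost surely 0 (X = 0 is stable but has P = 1), and the stated range of p is required for p_n = n^(-1/γ), all n ≥ 2; for m > 1 this means 2^(-1/γ) < κ, without which the "if" part fails (e.g. m = 2, κ = 0.3, γ = 1). *)

theory Defs
  imports "HOL-Probability.Probability"
begin

(* A non-negative integer-valued random variable enters only through its law, a nat pmf. *)

definition pgf :: "nat pmf \<Rightarrow> real \<Rightarrow> real" where
  "pgf X z = measure_pmf.expectation X (\<lambda>k. z ^ k)"

(* The law of the sum over j < n and i < X_j of eps_i^(j), where X_0, ..., X_(n-1) are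
   independent with law X and the eps_i^(j) are i.i.d. with law q, independent of the X_j.
   Only the finitely many eps_i^(j) that occur in the sum are drawn. The argument 0 of Pi_pmf
   is the value outside the index set and does not affect the sum. *)
definition thinned_sum :: "nat \<Rightarrow> nat pmf \<Rightarrow> nat pmf \<Rightarrow> nat pmf" where
  "thinned_sum n X q =
     bind_pmf (Pi_pmf {..<n} 0 (\<lambda>_. X)) (\<lambda>x.
       map_pmf (\<lambda>\<epsilon>. \<Sum>j<n. \<Sum>i<x j. \<epsilon> (j, i))
         (Pi_pmf (SIGMA j:{..<n}. {..<x j}) 0 (\<lambda>_. q)))"

(* "thinning p q" says that q is an allowed law of the thinning variables eps(p). *)
definition positive_discrete_stable :: "nat pmf \<Rightarrow> (real \<Rightarrow> nat pmf \<Rightarrow> bool) \<Rightarrow> bool" where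
  "positive_discrete_stable X thinning \<longleftrightarrow>
     (\<forall>n\<ge>2. \<exists>p. 0 < p \<and> p < 1 \<and> (\<exists>q. thinning p q \<and> X = thinned_sum n X q))"

definition mod_geometric_params :: "real \<Rightarrow> nat \<Rightarrow> real \<Rightarrow> bool" where
  "mod_geometric_params \<kappa> m p \<longleftrightarrow>
     (0 \<le> \<kappa> \<and> \<kappa> < 1 \<and> 0 < p \<and> p < 1 \<and> m = 1) \<or> (0 < p \<and> p < \<kappa> \<and> \<kappa> < 1 \<and> m > 1)"

definition mod_geometric_pgf :: "real \<Rightarrow> nat \<Rightarrow> real \<Rightarrow> real \<Rightarrow> real" where
  "mod_geometric_pgf \<kappa> m p z =
     (((1 - p) + (p - \<kappa>) * z ^ m) / ((1 - p * \<kappa>) - \<kappa> * (1 - p) * z ^ m)) powr (1 / real m)"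

(* q is the law G(p, kappa, m). A law on the naturals is determined by its probability
   generating function on [0,1]; there the base of the real power above is non-negative. *)
definition mod_geometric :: "real \<Rightarrow> nat \<Rightarrow> real \<Rightarrow> nat pmf \<Rightarrow> bool" where
  "mod_geometric \<kappa> m p q \<longleftrightarrow>
     mod_geometric_params \<kappa> m p \<and> (\<forall>z\<in>{0..1}. pgf q z = mod_geometric_pgf \<kappa> m p z)"

end

theory Submission
  imports Defs "HOL-Complex_Analysis.Cauchy_Integral_Formula"
begin

text \<open>
  Write \<open>w = (1 - z ^ m) / (1 - \<kappa> * z ^ m)\<close>. As \<open>z\<close> decreases from \<open>1\<close> to \<open>0\<close>, this
  coordinate increases from \<open>0\<close> to \<open>1\<close>, and it turns the thinning pgf into multiplication by
  \<open>p\<close>: the value \<open>w\<close> at \<open>Q(z)\<close> is \<open>p\<close> times the value at \<open>z\<close>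
  (\<open>mod_geometric_pgf_eq_mobius_root\<close>). Since a thinned sum has pgf \<open>P(Q(z)) ^ n\<close>
  (\<open>pgf_thinned_sum\<close>), stability says that \<open>G(w) = - ln P(z)\<close> solves
  \<open>G(w) = n * G(p\<^sub>n * w)\<close> for every \<open>n \<ge> 2\<close>.

  The function \<open>G\<close> is monotone because a pgf is, and this forces
  \<open>p\<^sub>n = n powr (-1 / \<gamma>)\<close> and \<open>G(w) = G(1) * w powr \<gamma>\<close> with a single exponent
  \<open>\<gamma> > 0\<close> (\<open>scaling_power_law\<close>): the quotients \<open>ln n / - ln p\<^sub>n\<close> are compared through
  powers of the \<open>p\<^sub>n\<close>, and the values of \<open>G\<close>, known at all rational powers
  \<open>(k / n) powr (1 / \<gamma>)\<close>, are interpolated by monotonicity. The bound \<open>\<gamma> \<le> 1\<close> comes from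
  the behaviour at \<open>z = 1\<close>: the difference \<open>1 - P(z)\<close> is at least of the order of \<open>1 - z\<close>
  unless \<open>X\<close> is concentrated at \<open>0\<close>, whereas the formula makes it of the order
  \<open>(1 - z) powr \<gamma>\<close> (\<open>pgf_power_law_exponent_le_1\<close>).

  Conversely, the stated pgf satisfies the scaling equation by inspection, and a law on the
  naturals is determined by its pgf (\<open>pgf_inject\<close>). What remains is that \<open>Q\<close> really is a
  pgf (\<open>mod_geometric_law_exists\<close>). For \<open>m = 1\<close> it belongs to a mixture of the point mass at
  \<open>0\<close> and a geometric law on the positive integers. For \<open>m > 1\<close> and \<open>p < \<kappa>\<close> one has
  \<open>Q(z) = (A * (1 - c * s) / (1 - b * s)) powr (1 / m)\<close> with \<open>s = z ^ m\<close> and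
  \<open>0 \<le> c < b < 1\<close>; the logarithm of this has nonnegative coefficients
  \<open>(b ^ k - c ^ k) / (k * m)\<close> at \<open>s ^ k\<close>, \<open>k \<ge> 1\<close>, so that \<open>Q\<close> is the pgf of \<open>m\<close> times
  a compound Poisson variable.
\<close>

section \<open>Probability generating functions\<close>

lemma integrable_power_pmf:
  fixes z :: real and X :: "nat pmf"
  assumes "z \<in> {0..1}"
  shows "integrable (measure_pmf X) (\<lambda>k. z ^ k)"
  by (rule measure_pmf.integrable_const_bound[where B = 1]) (use assms in \<open>auto simp: power_le_one\<close>)

lemma pgf_sums:
  assumes "z \<in> {0..1}"
  shows "(\<lambda>k. pmf X k * z ^ k) sums pgf X z"
proof -
  have "integrable (count_space UNIV) (\<lambda>k. pmf X k * z ^ k)"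
    using integrable_power_pmf[OF assms, of X]
    unfolding measure_pmf_eq_density by (subst (asm) integrable_density) auto
  moreover have "pgf X z = (\<integral>k. pmf X k * z ^ k \<partial>count_space UNIV)"
    unfolding pgf_def measure_pmf_eq_density by (subst integral_density) auto
  ultimately show ?thesis
    using sums_integral_count_space_nat by metis
qed

lemma pgf_eqI:
  assumes "z \<in> {0..1}" "(\<lambda>k. pmf X k * z ^ k) sums s"
  shows "pgf X z = s"
  using pgf_sums[OF assms(1)] assms(2) by (rule sums_unique2)

lemma pgf_1: "pgf X 1 = 1"
  by (simp add: pgf_def)

lemma pgf_le_1:
  assumes "z \<in> {0..1}"
  shows "pgf X z \<le> 1"
  unfolding pgf_def
  by (rule measure_pmf.integral_le_const[OF integrable_power_pmf[OF assms]])
    (use assms in \<open>auto simp: power_le_one\<close>)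

lemma pgf_nonneg: "z \<in> {0..1} \<Longrightarrow> 0 \<le> pgf X z"
  unfolding pgf_def by (rule integral_nonneg_AE) auto

lemma pgf_in_unit: "z \<in> {0..1} \<Longrightarrow> pgf X z \<in> {0..1}"
  by (simp add: pgf_le_1 pgf_nonneg)

lemma pgf_mono:
  assumes "0 \<le> y" "y \<le> z" "z \<le> 1"
  shows "pgf X y \<le> pgf X z"
  unfolding pgf_def
  by (intro integral_mono integrable_power_pmf power_mono) (use assms in auto)

lemma pgf_pos:
  assumes "0 < z" "z \<le> 1"
  shows "0 < pgf X z"
proof -
  obtain k where k: "k \<in> set_pmf X" using set_pmf_not_empty by fast
  have "0 < pmf X k * z ^ k" using k assms by (simp add: pmf_positive)
  also have "\<dots> \<le> pgf X z"
    using sum_le_suminf[of "\<lambda>k. pmf X k * z ^ k" "{k}"] pgf_sums[of z X] assms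
    by (simp add: sums_iff)
  finally show ?thesis .
qed

text \<open>
  Every power \<open>z ^ k\<close> with \<open>k > 0\<close> is at most \<open>z\<close>. Away from the degenerate law this is
  a linear lower bound for \<open>1 - P(z)\<close>; it yields both \<open>P(0) < 1\<close> and the bound on the
  stability exponent.
\<close>
lemma pgf_le_linear:
  assumes z: "z \<in> {0..1}"
  shows "pgf X z \<le> 1 - (1 - pmf X 0) * (1 - z)"
proof -
  have "pgf X z \<le> measure_pmf.expectation X (\<lambda>k. z + (1 - z) * indicator {0} k)"
    unfolding pgf_def
  proof (rule integral_mono)
    show "integrable (measure_pmf X) (\<lambda>k. z + (1 - z) * indicator {0} k)"
      by (rule measure_pmf.integrable_const_bound[where B = 1])
        (use z in \<open>auto split: split_indicator\<close>)
    fix k :: nat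
    have "z ^ k \<le> z ^ 1" if "k \<noteq> 0"
      using that z by (intro power_decreasing) auto
    then show "z ^ k \<le> z + (1 - z) * indicator {0} k"
      by (cases "k = 0") auto
  qed (use integrable_power_pmf z in auto)
  also have "\<dots> = z + (1 - z) * pmf X 0"
    using measure_pmf.integrable_const_bound[where M = X and f = "indicat_real {0}" and B = 1]
    by (subst Bochner_Integration.integral_add) (auto simp: measure_pmf_single)
  finally show ?thesis by (simp add: algebra_simps)
qed

lemma pmf_0_less_1:
  fixes X :: "nat pmf"
  assumes "X \<noteq> return_pmf 0"
  shows "pmf X 0 < 1"
proof (rule ccontr)
  assume "\<not> pmf X 0 < 1"
  then have "pmf X 0 = 1" using pmf_le_1[of X 0] by linarith
  then have "measure_pmf.prob X {0} = 1" by (simp add: measure_pmf_single)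
  then have "AE k in measure_pmf X. k \<in> {0}"
    by (subst (asm) measure_pmf.prob_eq_1) auto
  then have "set_pmf X \<subseteq> {0}" by (auto simp: AE_measure_pmf_iff)
  then show False using assms by (simp add: set_pmf_subset_singleton)
qed

text \<open>
  The two pgfs agree only on a real interval that has the centre \<open>0\<close> as an endpoint. That
  suffices, because a nonzero power series that vanishes at its centre has no other zero near it.
\<close>
lemma pgf_inject:
  assumes eq: "\<And>z. z \<in> {0..1} \<Longrightarrow> pgf X z = pgf Y z"
  shows "X = Y"
proof -
  define a where "a k = pmf X k - pmf Y k" for k
  define f where "f x = (\<Sum>k. a k * x ^ k)" for x
  have a_sums_0: "(\<lambda>k. a k * x ^ k) sums 0" if "x \<in> {0..1}" for x
    using sums_diff[OF pgf_sums[OF that, of X] pgf_sums[OF that, of Y]] eq[OF that]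
    by (simp add: a_def algebra_simps)
  have f_0: "f x = 0" if "x \<in> {0..1}" for x
    using a_sums_0[OF that] by (simp add: f_def sums_iff)
  have f_sums: "(\<lambda>k. a k * (x - 0) ^ k) sums f x" if "norm (x - 0) < 1" for x
  proof -
    have "summable (\<lambda>k. a k * x ^ k)"
      by (rule powser_inside[of _ 1]) (use a_sums_0[of 1] that in \<open>auto simp: sums_iff\<close>)
    then show ?thesis by (simp add: f_def sums_iff)
  qed
  have "a k = 0" for k
  proof (cases "k = 0")
    case True
    then show ?thesis using a_sums_0[of 0] by simp
  next
    case False
    show ?thesis
    proof (rule ccontr)
      assume "a k \<noteq> 0"
      then obtain s where s: "0 < s" "\<And>z. z \<in> cball 0 s - {0} \<Longrightarrow> f z \<noteq> 0"
        using powser_0_nonzero[OF zero_less_one f_sums f_0[of 0], of k] False by auto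
      then show False using f_0[of "min s 1"] s(2)[of "min s 1"] by auto
    qed
  qed
  then show ?thesis by (intro pmf_eqI) (simp add: a_def)
qed

text \<open>
  For functions with values in the unit interval the integrals over \<open>bind_pmf\<close> may be
  computed as nonnegative integrals, where no integrability conditions arise.
\<close>
lemma expectation_bind_pmf_unit:
  fixes h :: "'b \<Rightarrow> real"
  assumes h: "\<And>y. 0 \<le> h y" "\<And>y. h y \<le> 1"
  shows "measure_pmf.expectation (bind_pmf M N) h =
    measure_pmf.expectation M (\<lambda>x. measure_pmf.expectation (N x) h)"
proof -
  have int: "integrable (measure_pmf P) h" for P :: "'b pmf"
    by (rule measure_pmf.integrable_const_bound[where B = 1]) (use h in auto)
  have inner: "0 \<le> measure_pmf.expectation (N x) h" "measure_pmf.expectation (N x) h \<le> 1" for x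
    using h int by (auto intro!: integral_nonneg_AE measure_pmf.integral_le_const)
  have int': "integrable (measure_pmf M) (\<lambda>x. measure_pmf.expectation (N x) h)"
    by (rule measure_pmf.integrable_const_bound[where B = 1]) (use inner in auto)
  have "ennreal (measure_pmf.expectation (bind_pmf M N) h) = (\<integral>\<^sup>+x. ennreal (h x) \<partial>bind_pmf M N)"
    using int h by (intro nn_integral_eq_integral[symmetric]) auto
  also have "\<dots> = (\<integral>\<^sup>+x. \<integral>\<^sup>+y. ennreal (h y) \<partial>N x \<partial>M)"
    by (rule nn_integral_bind_pmf)
  also have "\<dots> = (\<integral>\<^sup>+x. ennreal (measure_pmf.expectation (N x) h) \<partial>M)"
    using int h by (simp add: nn_integral_eq_integral)
  also have "\<dots> = ennreal (measure_pmf.expectation M (\<lambda>x. measure_pmf.expectation (N x) h))"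
    using int' inner by (simp add: nn_integral_eq_integral)
  finally show ?thesis
    using h inner by (subst (asm) ennreal_inj) (auto intro!: integral_nonneg_AE)
qed

text \<open>
  Conditionally on the \<open>X\<^sub>j\<close> the sum has \<open>X\<^sub>0 + \<dots> + X\<^bsub>n-1\<^esub>\<close> independent
  summands, so its conditional pgf is \<open>pgf q z\<close> to that power; averaging over the independent
  \<open>X\<^sub>j\<close> evaluates \<open>pgf X\<close> at \<open>pgf q z\<close> in each of the \<open>n\<close> factors. With
  \<open>n = 1\<close> this is the pgf of a random sum, which gives mixtures and compound Poisson laws below.
\<close>
lemma pgf_thinned_sum:
  assumes z: "z \<in> {0..1}"
  shows "pgf (thinned_sum n X q) z = pgf X (pgf q z) ^ n"
proof -
  have inner: "measure_pmf.expectation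
      (Pi_pmf (SIGMA j:{..<n}. {..<x j}) 0 (\<lambda>_. q)) (\<lambda>\<epsilon>. z ^ (\<Sum>j<n. \<Sum>i<x j. \<epsilon> (j, i))) =
      (\<Prod>j<n. pgf q z ^ x j)" for x :: "nat \<Rightarrow> nat"
  proof -
    let ?I = "SIGMA j:{..<n}. {..<x j}"
    have "(\<Sum>j<n. \<Sum>i<x j. \<epsilon> (j, i)) = (\<Sum>u\<in>?I. \<epsilon> u)" for \<epsilon> :: "nat \<times> nat \<Rightarrow> nat"
      by (subst sum.Sigma) auto
    then have "measure_pmf.expectation (Pi_pmf ?I 0 (\<lambda>_. q)) (\<lambda>\<epsilon>. z ^ (\<Sum>j<n. \<Sum>i<x j. \<epsilon> (j, i))) =
       measure_pmf.expectation (Pi_pmf ?I 0 (\<lambda>_. q)) (\<lambda>\<epsilon>. \<Prod>u\<in>?I. z ^ \<epsilon> u)"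
      by (simp add: power_sum)
    also have "\<dots> = (\<Prod>u\<in>?I. pgf q z)"
      unfolding pgf_def
      by (rule expectation_prod_Pi_pmf) (use integrable_power_pmf z in auto)
    also have "\<dots> = (\<Prod>j<n. \<Prod>i<x j. pgf q z)"
      by (subst prod.Sigma) auto
    finally show ?thesis by simp
  qed
  have "pgf (thinned_sum n X q) z =
      measure_pmf.expectation (Pi_pmf {..<n} 0 (\<lambda>_. X)) (\<lambda>x. \<Prod>j<n. pgf q z ^ x j)"
    unfolding pgf_def thinned_sum_def
    by (subst expectation_bind_pmf_unit)
      (use z inner in \<open>auto simp: pgf_def power_le_one\<close>)
  also have "\<dots> = (\<Prod>j<n. pgf X (pgf q z))"
    unfolding pgf_def[of X]
    by (rule expectation_prod_Pi_pmf) (use integrable_power_pmf pgf_in_unit z pgf_nonneg in auto)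
  finally show ?thesis by simp
qed

section \<open>Existence of the modified geometric laws\<close>

lemma one_minus_mult_pos:
  fixes \<kappa> s :: real
  assumes "0 \<le> \<kappa>" "\<kappa> < 1" "s \<in> {0..1}"
  shows "0 < 1 - \<kappa> * s"
  using assms mult_left_le[of s \<kappa>] by auto

lemma power_in_unit: "(z::real) \<in> {0..1} \<Longrightarrow> z ^ m \<in> {0..1}"
  by (simp add: power_le_one)

lemma pgf_map_mult: "pgf (map_pmf (\<lambda>k. m * k) q) z = pgf q (z ^ m)"
  by (simp add: pgf_def power_mult)

lemma pgf_poisson:
  assumes "0 < \<mu>" "z \<in> {0..1}"
  shows "pgf (poisson_pmf \<mu>) z = exp (\<mu> * (z - 1))"
proof (rule pgf_eqI)
  have "(\<lambda>k. exp (- \<mu>) * ((\<mu> * z) ^ k /\<^sub>R fact k)) sums (exp (- \<mu>) * exp (\<mu> * z))"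
    by (intro sums_mult exp_converges)
  then show "(\<lambda>k. pmf (poisson_pmf \<mu>) k * z ^ k) sums exp (\<mu> * (z - 1))"
    using assms by (simp add: exp_add[symmetric] algebra_simps power_mult_distrib divide_inverse)
qed (use assms in auto)

lemma pgf_bernoulli:
  assumes "0 \<le> r" "r \<le> 1"
  shows "pgf (map_pmf of_bool (bernoulli_pmf r)) z = 1 - r + r * z"
  using assms by (simp add: pgf_def)

lemma pgf_shifted_geometric:
  assumes b: "0 \<le> b" "b < 1" and z: "z \<in> {0..1}"
  shows "pgf (map_pmf Suc (geometric_pmf (1 - b))) z = z * (1 - b) / (1 - b * z)"
proof -
  have "b * z < 1" using one_minus_mult_pos[OF b z] by simp
  then have "(\<lambda>k. (1 - b) * (b * z) ^ k) sums ((1 - b) * (1 / (1 - b * z)))"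
    using b z by (intro sums_mult geometric_sums) auto
  then have "pgf (geometric_pmf (1 - b)) z = (1 - b) / (1 - b * z)"
    using b z by (intro pgf_eqI) (auto simp: power_mult_distrib mult_ac)
  moreover have "pgf (map_pmf Suc (geometric_pmf (1 - b))) z = z * pgf (geometric_pmf (1 - b)) z"
    by (simp add: pgf_def)
  ultimately show ?thesis by simp
qed

lemma pmf_of_sums_1:
  fixes f :: "nat \<Rightarrow> real"
  assumes nonneg: "\<And>k. 0 \<le> f k" and "f sums 1"
  obtains q where "\<And>k. pmf q k = f k"
proof -
  have "(\<integral>\<^sup>+k. ennreal (f k) \<partial>count_space UNIV) = 1"
    using suminf_ennreal_eq[OF nonneg assms(2)] by (simp add: nn_integral_count_space_nat)
  from pmf_embed_pmf[of f, OF nonneg this] show ?thesis using that by blast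
qed

text \<open>
  Subtracting the series of \<open>- ln (1 - c * z)\<close> from that of \<open>- ln (1 - b * z)\<close> leaves the
  coefficients \<open>(b ^ k - c ^ k) / k\<close>, which are nonnegative because \<open>c < b\<close>; dividing by
  the value at \<open>z = 1\<close> normalises them. This is the jump law of the compound Poisson law below.
\<close>
lemma logarithmic_law:
  fixes b c :: real
  assumes cb: "0 \<le> c" "c < b" "b < 1"
  obtains g where "\<And>z. z \<in> {0..1} \<Longrightarrow>
    pgf g z = ln ((1 - c * z) / (1 - b * z)) / ln ((1 - c) / (1 - b))"
proof -
  define L where "L = ln ((1 - c) / (1 - b))"
  define f where "f k = (b ^ k - c ^ k) / real k / L" for k
  have "0 < L" unfolding L_def using cb by (intro ln_gt_zero) auto
  have log_sums: "(\<lambda>k. (x * z) ^ k / real k) sums - ln (1 - x * z)"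
    if "0 \<le> x" "x < 1" "z \<in> {0..1}" for x z :: real
  proof -
    have "x * z < 1" using one_minus_mult_pos[OF that] by simp
    then show ?thesis using sums_minus[OF ln_series'[of "- (x * z)"]] that by simp
  qed
  have f_sums: "(\<lambda>k. f k * z ^ k) sums (ln ((1 - c * z) / (1 - b * z)) / L)"
    if z: "z \<in> {0..1}" for z
  proof -
    have "c * z < 1" "b * z < 1"
      using one_minus_mult_pos[of c z] one_minus_mult_pos[of b z] cb z by auto
    then have "ln ((1 - c * z) / (1 - b * z)) = - ln (1 - b * z) - - ln (1 - c * z)"
      by (simp add: ln_div)
    moreover have "f k * z ^ k = ((b * z) ^ k / real k - (c * z) ^ k / real k) / L" for k
      by (simp add: f_def power_mult_distrib diff_divide_distrib left_diff_distrib)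
    ultimately show ?thesis
      using sums_divide[OF sums_diff[OF log_sums[of b z] log_sums[of c z]], of L] cb z by simp
  qed
  have "0 \<le> f k" for k
    unfolding f_def using cb \<open>0 < L\<close> by (simp add: power_mono)
  moreover have "f sums 1"
    using f_sums[of 1] \<open>0 < L\<close> by (simp add: L_def)
  ultimately obtain g where g: "\<And>k. pmf g k = f k" by (rule pmf_of_sums_1) auto
  show ?thesis
    by (rule that[of g]) (rule pgf_eqI, auto simp: g L_def[symmetric] f_sums)
qed

text \<open>
  A compound Poisson law of rate \<open>\<mu>\<close> with jump pgf \<open>g\<close> has pgf
  \<open>exp (\<mu> * (g - 1))\<close>. For the logarithmic jump law, \<open>L * (g - 1)\<close> is the logarithm of
  the normalised quotient, where \<open>L\<close> is the normalising constant of that law; the rate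
  \<open>\<alpha> * L\<close> therefore produces the exponent \<open>\<alpha>\<close>, which need not be an integer.
\<close>
lemma compound_poisson_power_law:
  fixes b c \<alpha> :: real
  assumes cb: "0 \<le> c" "c < b" "b < 1" and \<alpha>: "0 < \<alpha>"
  obtains q where "\<And>s. s \<in> {0..1} \<Longrightarrow>
    pgf q s = (((1 - c * s) / (1 - b * s)) / ((1 - c) / (1 - b))) powr \<alpha>"
proof -
  define L where "L = ln ((1 - c) / (1 - b))"
  have L: "0 < L" unfolding L_def using cb by (intro ln_gt_zero) auto
  obtain g where g: "\<And>s. s \<in> {0..1} \<Longrightarrow> pgf g s = ln ((1 - c * s) / (1 - b * s)) / L"
    using logarithmic_law[OF cb] unfolding L_def by blast
  define q where "q = thinned_sum 1 (poisson_pmf (\<alpha> * L)) g"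
  have "pgf q s = (((1 - c * s) / (1 - b * s)) / ((1 - c) / (1 - b))) powr \<alpha>"
    if s: "s \<in> {0..1}" for s
  proof -
    define R where "R = (1 - c * s) / (1 - b * s)"
    have "0 < R"
      unfolding R_def using one_minus_mult_pos[of _ s] cb s by (intro divide_pos_pos) auto
    have "pgf q s = exp (\<alpha> * L * (pgf g s - 1))"
      unfolding q_def using pgf_thinned_sum[OF s, of 1] pgf_poisson[of "\<alpha> * L"]
        pgf_in_unit[OF s] \<alpha> L by simp
    also have "\<alpha> * L * (pgf g s - 1) = \<alpha> * (ln R - L)"
      using g[OF s] L by (simp add: R_def field_simps)
    also have "\<dots> = \<alpha> * ln (R / ((1 - c) / (1 - b)))"
      using cb \<open>0 < R\<close> ln_div[of R "(1 - c) / (1 - b)"] by (simp add: L_def)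
    finally show ?thesis
      using cb \<open>0 < R\<close> unfolding R_def[symmetric] powr_def by simp
  qed
  then show ?thesis using that by blast
qed

lemma mod_geometric_paramsD:
  assumes "mod_geometric_params \<kappa> m p"
  shows "0 \<le> \<kappa>" "\<kappa> < 1" "1 \<le> m" "0 < p" "p < 1"
  using assms by (auto simp: mod_geometric_params_def)

text \<open>
  The mass at \<open>0\<close> is \<open>Q(0) = (1 - p) / d\<close> with \<open>d = 1 - p * \<kappa>\<close>; conditionally on
  being positive, the law is geometric, and its ratio \<open>b\<close> is the reciprocal of the pole of
  \<open>Q\<close> (or \<open>0\<close> if \<open>\<kappa> = 0\<close>). Hence the mixture below, with weight \<open>r = 1 - Q(0)\<close> on the positive part.
\<close>
lemma geometric_law_exists:
  assumes \<kappa>: "0 \<le> \<kappa>" "\<kappa> < 1" and p: "0 < p" "p < 1"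
  obtains q where "mod_geometric \<kappa> 1 p q"
proof -
  define d where "d = 1 - p * \<kappa>"
  define b where "b = \<kappa> * (1 - p) / d"
  define r where "r = p * (1 - \<kappa>) / d"
  have d: "0 < d" using one_minus_mult_pos[of \<kappa> p] \<kappa> p by (simp add: d_def mult.commute)
  have b1: "1 - b = (1 - \<kappa>) / d" and r1: "1 - r = (1 - p) / d"
    using d by (auto simp: b_def r_def d_def field_simps)
  have b: "0 \<le> b" "b < 1"
  proof -
    show "0 \<le> b" using \<kappa> p d by (simp add: b_def)
    have "0 < 1 - b" unfolding b1 using d \<kappa> by simp
    then show "b < 1" by simp
  qed
  have r: "0 \<le> r" "r \<le> 1"
  proof -
    show "0 \<le> r" using \<kappa> p d by (simp add: r_def)
    have "0 \<le> 1 - r" unfolding r1 using d p by simp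
    then show "r \<le> 1" by simp
  qed
  define q where "q = thinned_sum 1 (map_pmf of_bool (bernoulli_pmf r))
    (map_pmf Suc (geometric_pmf (1 - b)))"
  have "pgf q z = mod_geometric_pgf \<kappa> 1 p z" if z: "z \<in> {0..1}" for z
  proof -
    have "0 < 1 - b * z" by (rule one_minus_mult_pos[OF b z])
    moreover have bz: "1 - b * z = (d - \<kappa> * (1 - p) * z) / d"
      using d by (simp add: b_def field_simps)
    ultimately have e: "0 < d - \<kappa> * (1 - p) * z"
      using d by (simp add: zero_less_divide_iff)
    have "pgf q z = 1 - r + r * (z * (1 - b) / (1 - b * z))"
      unfolding q_def using pgf_thinned_sum[OF z, of 1] pgf_bernoulli[OF r]
        pgf_shifted_geometric[OF b z] by simp
    also have "\<dots> = (1 - p) / d + p * (1 - \<kappa>) / d * (z * (1 - \<kappa>) / (d - \<kappa> * (1 - p) * z))"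
      unfolding r1 bz b1 using d e by (simp add: r_def)
    also have "\<dots> = ((1 - p) * (d - \<kappa> * (1 - p) * z) + p * (1 - \<kappa>)\<^sup>2 * z) / (d * (d - \<kappa> * (1 - p) * z))"
      using d e by (simp add: add_divide_distrib power2_eq_square mult_ac)
    also have "(1 - p) * (d - \<kappa> * (1 - p) * z) + p * (1 - \<kappa>)\<^sup>2 * z = d * ((1 - p) + (p - \<kappa>) * z)"
      by (simp add: d_def algebra_simps power2_eq_square)
    also have "d * ((1 - p) + (p - \<kappa>) * z) / (d * (d - \<kappa> * (1 - p) * z)) =
        ((1 - p) + (p - \<kappa>) * z) / (d - \<kappa> * (1 - p) * z)"
      using d by simp
    also have "\<dots> = mod_geometric_pgf \<kappa> 1 p z"
    proof -
      have "0 \<le> (1 - p) + (p - \<kappa>) * z"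
      proof -
        have "(1 - p) + (p - \<kappa>) * z = (1 - p) * (1 - z) + (1 - \<kappa>) * z" by (simp add: algebra_simps)
        then show ?thesis using p \<kappa> z by simp
      qed
      then show ?thesis using e by (simp add: mod_geometric_pgf_def d_def)
    qed
    finally show ?thesis .
  qed
  then have "mod_geometric \<kappa> 1 p q"
    using \<kappa> p by (simp add: mod_geometric_def mod_geometric_params_def)
  then show ?thesis by (rule that)
qed

text \<open>
  For \<open>m > 1\<close> the base of the root, as a function of \<open>s = z ^ m\<close>, has its zero at
  \<open>1 / c\<close> and its pole at \<open>1 / b\<close>. The condition \<open>p < \<kappa>\<close> makes \<open>c\<close> positive, so
  that the compound Poisson construction applies; multiplying its values by \<open>m\<close> substitutes
  \<open>z ^ m\<close> for \<open>s\<close>.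
\<close>
lemma mod_geometric_law_exists:
  assumes "mod_geometric_params \<kappa> m p"
  obtains q where "mod_geometric \<kappa> m p q"
proof (cases "m = 1")
  case True
  then show ?thesis using geometric_law_exists mod_geometric_paramsD[OF assms] that by metis
next
  case False
  then have p: "0 < p" "p < \<kappa>" "\<kappa> < 1" and m: "1 < m"
    using assms by (auto simp: mod_geometric_params_def)
  define d where "d = 1 - p * \<kappa>"
  define b where "b = \<kappa> * (1 - p) / d"
  define c where "c = (\<kappa> - p) / (1 - p)"
  have d: "0 < d" using one_minus_mult_pos[of \<kappa> p] p by (simp add: d_def mult.commute)
  have b1: "1 - b = (1 - \<kappa>) / d" and c1: "1 - c = (1 - \<kappa>) / (1 - p)"
    using d p by (auto simp: b_def c_def d_def field_simps)
  have cb: "0 \<le> c" "c < b" "b < 1"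
  proof -
    show "0 \<le> c" using p by (simp add: c_def)
    have "1 - p < d" using p by (simp add: d_def)
    then have "1 - b < 1 - c" unfolding b1 c1 using p by (intro divide_strict_left_mono) auto
    then show "c < b" by simp
    have "0 < 1 - b" unfolding b1 using d p by simp
    then show "b < 1" by simp
  qed
  obtain q where q: "\<And>s. s \<in> {0..1} \<Longrightarrow>
      pgf q s = (((1 - c * s) / (1 - b * s)) / ((1 - c) / (1 - b))) powr (1 / real m)"
    using compound_poisson_power_law[OF cb, of "1 / real m"] m by auto
  have base: "((1 - c * s) / (1 - b * s)) / ((1 - c) / (1 - b)) =
      ((1 - p) + (p - \<kappa>) * s) / (d - \<kappa> * (1 - p) * s)" if "s \<in> {0..1}" for s
  proof -
    have "1 - c * s = ((1 - p) + (p - \<kappa>) * s) / (1 - p)"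
      "1 - b * s = (d - \<kappa> * (1 - p) * s) / d"
      using d p by (auto simp: b_def c_def field_simps)
    then show ?thesis unfolding b1 c1 using d p by simp
  qed
  have "pgf (map_pmf (\<lambda>k. m * k) q) z = mod_geometric_pgf \<kappa> m p z" if z: "z \<in> {0..1}" for z
    unfolding pgf_map_mult q[OF power_in_unit[OF z]] base[OF power_in_unit[OF z]]
      mod_geometric_pgf_def d_def ..
  then have "mod_geometric \<kappa> m p (map_pmf (\<lambda>k. m * k) q)"
    using assms by (simp add: mod_geometric_def)
  then show ?thesis by (rule that)
qed

section \<open>The thinning pgf as a contraction in a Moebius coordinate\<close>

definition mobius :: "real \<Rightarrow> real \<Rightarrow> real" where
  "mobius \<kappa> s = (1 - s) / (1 - \<kappa> * s)"

lemma mobius_in_unit: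
  assumes "0 \<le> \<kappa>" "\<kappa> < 1" "s \<in> {0..1}"
  shows "mobius \<kappa> s \<in> {0..1}"
  using assms one_minus_mult_pos[OF assms] mult_right_mono[of \<kappa> 1 s]
  by (auto simp: mobius_def divide_le_eq)

lemma mobius_pos:
  assumes "0 \<le> \<kappa>" "\<kappa> < 1" "0 \<le> s" "s < 1"
  shows "0 < mobius \<kappa> s"
  using assms one_minus_mult_pos[of \<kappa> s] by (simp add: mobius_def)

text \<open>
  The map is its own inverse, so one function serves both as the coordinate \<open>w\<close> of
  \<open>s = z ^ m\<close> and as the way back.
\<close>
lemma mobius_involution:
  assumes "0 \<le> \<kappa>" "\<kappa> < 1" "s \<in> {0..1}"
  shows "mobius \<kappa> (mobius \<kappa> s) = s"
proof -
  have d: "1 - \<kappa> * s \<noteq> 0" using one_minus_mult_pos[OF assms] by simp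
  have "1 - mobius \<kappa> s = (1 - \<kappa>) * s / (1 - \<kappa> * s)"
    "1 - \<kappa> * mobius \<kappa> s = (1 - \<kappa>) / (1 - \<kappa> * s)"
    using d by (auto simp: mobius_def field_simps)
  then show ?thesis using d assms by (simp add: mobius_def[of \<kappa> "mobius \<kappa> s"])
qed

lemma mobius_antimono:
  assumes "0 \<le> \<kappa>" "\<kappa> < 1" "0 \<le> s" "s \<le> t" "t \<le> 1"
  shows "mobius \<kappa> t \<le> mobius \<kappa> s"
proof -
  have "0 < 1 - \<kappa> * s" "0 < 1 - \<kappa> * t" using assms one_minus_mult_pos[of \<kappa>] by auto
  moreover have "(1 - t) * (1 - \<kappa> * s) \<le> (1 - s) * (1 - \<kappa> * t)"
    using assms mult_right_mono[of \<kappa> 1 "t - s"] by (simp add: algebra_simps)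
  ultimately show ?thesis by (simp add: mobius_def divide_le_eq le_divide_eq mult.commute)
qed

text \<open>
  The point \<open>z\<close> of the unit interval that has the coordinate \<open>w\<close>.
\<close>
definition mobius_root :: "real \<Rightarrow> nat \<Rightarrow> real \<Rightarrow> real" where
  "mobius_root \<kappa> m w = mobius \<kappa> w powr (1 / real m)"

lemma mobius_root_in_unit:
  assumes "0 \<le> \<kappa>" "\<kappa> < 1" "w \<in> {0..1}"
  shows "mobius_root \<kappa> m w \<in> {0..1}"
  using mobius_in_unit[OF assms] by (auto simp: mobius_root_def intro: powr_le1)

lemma mobius_root_power:
  assumes "0 \<le> \<kappa>" "\<kappa> < 1" "w \<in> {0..1}" "1 \<le> m"
  shows "mobius_root \<kappa> m w ^ m = mobius \<kappa> w"
proof (cases "mobius \<kappa> w = 0")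
  case False
  then show ?thesis
    using mobius_in_unit[OF assms(1-3)] assms(4)
    by (simp add: mobius_root_def powr_powr flip: powr_realpow)
qed (use assms(4) in \<open>simp add: mobius_root_def\<close>)

lemma mobius_root_mobius:
  assumes "0 \<le> \<kappa>" "\<kappa> < 1" "z \<in> {0..1}" "1 \<le> m"
  shows "mobius_root \<kappa> m (mobius \<kappa> (z ^ m)) = z"
proof -
  have "mobius_root \<kappa> m (mobius \<kappa> (z ^ m)) = (z ^ m) powr (1 / real m)"
    using assms by (simp add: mobius_root_def mobius_involution power_le_one)
  also have "\<dots> = z"
    using assms by (cases "z = 0") (auto simp: powr_powr zero_power simp flip: powr_realpow)
  finally show ?thesis .
qed

lemma mobius_root_antimono:
  assumes "0 \<le> \<kappa>" "\<kappa> < 1" "0 \<le> v" "v \<le> w" "w \<le> 1"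
  shows "mobius_root \<kappa> m w \<le> mobius_root \<kappa> m v"
  unfolding mobius_root_def
  using assms mobius_in_unit[of \<kappa> w] mobius_antimono[of \<kappa> v w]
  by (intro powr_mono2) auto

text \<open>
  On the level of \<open>s = z ^ m\<close>, thinning is conjugate to \<open>w \<mapsto> p * w\<close> under the
  involution: for \<open>\<kappa> > 0\<close> the Moebius map on the left fixes \<open>1\<close> and
  \<open>1 / \<kappa>\<close>, which correspond to
  \<open>w = 0\<close> and \<open>w = \<infinity>\<close>.
\<close>
lemma mod_geometric_base_eq_mobius:
  assumes "0 \<le> \<kappa>" "\<kappa> < 1" "s \<in> {0..1}"
  shows "((1 - p) + (p - \<kappa>) * s) / ((1 - p * \<kappa>) - \<kappa> * (1 - p) * s) =
    mobius \<kappa> (p * mobius \<kappa> s)"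
proof -
  have d: "1 - \<kappa> * s \<noteq> 0" using one_minus_mult_pos[OF assms] by simp
  have "1 - p * mobius \<kappa> s = ((1 - p) + (p - \<kappa>) * s) / (1 - \<kappa> * s)"
    "1 - \<kappa> * (p * mobius \<kappa> s) = ((1 - p * \<kappa>) - \<kappa> * (1 - p) * s) / (1 - \<kappa> * s)"
    using d by (auto simp: mobius_def field_simps)
  then show ?thesis using d by (simp add: mobius_def[of \<kappa> "p * mobius \<kappa> s"])
qed

lemma mod_geometric_pgf_eq_mobius_root:
  assumes "0 \<le> \<kappa>" "\<kappa> < 1" "z \<in> {0..1}"
  shows "mod_geometric_pgf \<kappa> m p z = mobius_root \<kappa> m (p * mobius \<kappa> (z ^ m))"
  using assms
  by (simp add: mod_geometric_pgf_def mobius_root_def mod_geometric_base_eq_mobius power_le_one)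

section \<open>Monotone solutions of the scaling equation\<close>

lemma scaling_iterate:
  fixes G :: "real \<Rightarrow> real"
  assumes "0 < c" "c < 1"
    and "\<And>w. 0 < w \<Longrightarrow> w \<le> 1 \<Longrightarrow> G w = real n * G (c * w)"
    and "0 < w" "w \<le> 1"
  shows "G w = real n ^ i * G (c ^ i * w)"
proof (induction i)
  case (Suc i)
  have "c ^ i * w \<le> 1" using assms by (intro mult_le_one power_le_one) auto
  then have "G (c ^ i * w) = real n * G (c * (c ^ i * w))"
    using assms by (intro assms(3)) auto
  then show ?case using Suc by (simp add: algebra_simps)
qed simp

text \<open>
  If the inequality failed, some rational \<open>i / j\<close> would lie strictly between
  \<open>ln (p k) / ln (p n)\<close> and \<open>ln k / ln n\<close>. Then \<open>p n ^ i < p k ^ j\<close> although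
  \<open>n ^ i < k ^ j\<close>, while the iterated equation gives \<open>G (p n ^ i) = G 1 / n ^ i\<close> and
  \<open>G (p k ^ j) = G 1 / k ^ j\<close>; this contradicts the monotonicity of \<open>G\<close>.
\<close>
lemma scaling_exponent_le:
  fixes G :: "real \<Rightarrow> real" and p :: "nat \<Rightarrow> real"
  assumes mono: "\<And>v w. 0 < v \<Longrightarrow> v \<le> w \<Longrightarrow> w \<le> 1 \<Longrightarrow> G v \<le> G w"
    and pos: "0 < G 1"
    and p: "\<And>n. n \<ge> 2 \<Longrightarrow> 0 < p n \<and> p n < 1"
    and scale: "\<And>n w. n \<ge> 2 \<Longrightarrow> 0 < w \<Longrightarrow> w \<le> 1 \<Longrightarrow> G w = real n * G (p n * w)"
    and nk: "n \<ge> 2" "k \<ge> 2"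
  shows "ln k / - ln (p k) \<le> ln n / - ln (p n)"
proof (rule ccontr)
  define a b where "a = - ln (p n)" and "b = - ln (p k)"
  have ab: "0 < a" "0 < b"
    using p[OF nk(1)] p[OF nk(2)] by (auto simp: a_def b_def)
  have lns: "0 < ln (real n)" "0 < ln (real k)" using nk by auto
  assume "\<not> ?thesis"
  then have "b / a < ln k / ln n"
    using ab lns by (simp add: a_def[symmetric] b_def[symmetric] field_simps)
  then obtain r :: rat where r: "b / a < of_rat r" "of_rat r < ln k / ln n"
    using of_rat_dense by blast
  have "0 < real_of_rat r" using r(1) divide_pos_pos[OF ab(2,1)] by linarith
  then have "0 < r" by simp
  then obtain i j :: nat where ij: "j > 0" "real_of_rat r = i / j"
  proof -
    obtain x y where xy: "quotient_of r = (x, y)" by (cases "quotient_of r")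
    have "y > 0" using quotient_of_denom_pos[OF xy] .
    moreover have "r = of_int x / of_int y" using quotient_of_div[OF xy] .
    moreover have "x > 0" using \<open>0 < r\<close> calculation by (simp add: zero_less_divide_iff)
    ultimately show ?thesis
      by (intro that[of "nat y" "nat x"]) (auto simp: of_rat_divide)
  qed
  have 1: "b * j < i * a" and 2: "i * ln n < j * ln k"
    using r ij ab lns by (auto simp: field_simps)
  have pp: "0 < p n" "0 < p k" using p nk by auto
  have "ln (p n ^ i) < ln (p k ^ j)"
    using 1 pp by (simp add: ln_realpow a_def b_def algebra_simps)
  then have "p n ^ i < p k ^ j" using pp by simp
  moreover have "p k ^ j \<le> 1" using p[OF nk(2)] by (intro power_le_one) auto
  ultimately have "G (p n ^ i) \<le> G (p k ^ j)" using pp by (intro mono) auto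
  moreover have iter: "G (p l ^ h) = G 1 / real l ^ h" if "l \<ge> 2" for l h
    using scaling_iterate[of "p l" G l 1 h] scale[OF that] p[OF that] that by simp
  ultimately have "G 1 / real n ^ i \<le> G 1 / real k ^ j"
    using iter[OF nk(1), of i] iter[OF nk(2), of j] by simp
  then have "real k ^ j \<le> real n ^ i"
    using pos nk by (simp add: divide_le_cancel frac_le_eq field_simps)
  then have "ln (real k ^ j) \<le> ln (real n ^ i)" using nk by simp
  then show False using 2 nk by (simp add: ln_realpow)
qed

text \<open>
  By the preceding comparison, applied in both directions, \<open>ln n / - ln (p n)\<close> is a constant
  \<open>\<gamma>\<close>. The point \<open>u = (k / n) powr (1 / \<gamma>)\<close> satisfies \<open>p k * u = p n\<close>
  (with \<open>1\<close> in place of \<open>p 1\<close>), whence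
  \<open>G u / k = G 1 / n\<close>. So the power law holds at a dense set of points, and monotonicity
  extends it to all others.
\<close>
lemma scaling_power_law:
  fixes G :: "real \<Rightarrow> real" and p :: "nat \<Rightarrow> real"
  assumes mono: "\<And>v w. 0 < v \<Longrightarrow> v \<le> w \<Longrightarrow> w \<le> 1 \<Longrightarrow> G v \<le> G w"
    and pos: "0 < G 1"
    and p: "\<And>n. n \<ge> 2 \<Longrightarrow> 0 < p n \<and> p n < 1"
    and scale: "\<And>n w. n \<ge> 2 \<Longrightarrow> 0 < w \<Longrightarrow> w \<le> 1 \<Longrightarrow> G w = real n * G (p n * w)"
  shows "\<exists>\<gamma>>0. (\<forall>n\<ge>2. p n = real n powr (-1 / \<gamma>)) \<and>
    (\<forall>w. 0 < w \<longrightarrow> w \<le> 1 \<longrightarrow> G w = G 1 * w powr \<gamma>)"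
proof -
  define \<gamma> where "\<gamma> = ln 2 / - ln (p 2)"
  have \<gamma>: "0 < \<gamma>" unfolding \<gamma>_def using p[of 2] by (intro divide_pos_pos) auto
  have le: "ln (real k) / - ln (p k) \<le> ln (real n) / - ln (p n)" if "n \<ge> 2" "k \<ge> 2" for n k
    using mono pos p scale that by (rule scaling_exponent_le[of G p])
  have p_eq: "p n = real n powr (-1 / \<gamma>)" if "n \<ge> 2" for n
  proof -
    have "ln n / - ln (p n) = \<gamma>"
      using le[OF that order_refl] le[OF order_refl that] by (simp add: \<gamma>_def)
    moreover have "ln (p n) < 0" using p[OF that] by simp
    ultimately have "ln (p n) = - 1 / \<gamma> * ln n" using \<gamma> by (auto simp: field_simps)
    then have "exp (ln (p n)) = real n powr (-1 / \<gamma>)" using that by (simp add: powr_def)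
    then show ?thesis using p[OF that] by simp
  qed
  have scale1: "G (real n powr (-1 / \<gamma>) * w) = G w / n" if "n \<ge> 1" "0 < w" "w \<le> 1" for n w
    using that scale[of n w] p_eq[of n] by (cases "n = 1") auto
  have rational: "G ((real k / real n) powr (1 / \<gamma>)) = G 1 * (real k / real n)"
    if kn: "1 \<le> k" "k \<le> n" for k n
  proof -
    define u where "u = (real k / real n) powr (1 / \<gamma>)"
    have u: "0 < u" "u \<le> 1" using kn \<gamma> by (auto simp: u_def intro!: powr_le1)
    have "real k powr (-1 / \<gamma>) * u = real n powr (-1 / \<gamma>) * 1"
      using kn by (simp add: u_def powr_divide powr_minus field_simps)
    then have "G u / k = G 1 / n"
      using scale1[of k u] scale1[of n 1] u kn by simp
    then show ?thesis using kn by (simp add: u_def field_simps)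
  qed
  have rational': "G (r powr (1 / \<gamma>)) = G 1 * r" if r: "r \<in> \<rat>" "0 < r" "r \<le> 1" for r
  proof -
    obtain k n :: nat where kn: "n \<noteq> 0" "\<bar>r\<bar> = real k / real n"
      using r(1) by (rule Rats_abs_nat_div_natE)
    then have "r = real k / real n" using r by simp
    moreover from this have "k \<noteq> 0" "real k \<le> real n"
      using r(2,3) kn(1) by (auto simp: divide_le_eq_1 intro: Nat.gr0I)
    ultimately show ?thesis using rational[of k n] by simp
  qed
  have "G w = G 1 * w powr \<gamma>" if w: "0 < w" "w \<le> 1" for w
  proof (rule antisym; rule ccontr)
    have wg: "0 < w powr \<gamma>" "w powr \<gamma> \<le> 1" using w \<gamma> by (auto intro!: powr_le1)
    have root: "(w powr \<gamma>) powr (1 / \<gamma>) = w" using w \<gamma> by (simp add: powr_powr)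
    show False if "\<not> G w \<le> G 1 * w powr \<gamma>"
    proof -
      have "w powr \<gamma> < G w / G 1" using that pos by (simp add: field_simps)
      then obtain r where r: "r \<in> \<rat>" "w powr \<gamma> < r" "r < G w / G 1"
        using Rats_dense_in_real by blast
      have "G w \<le> G 1" using mono w by simp
      then have "G w / G 1 \<le> 1" using pos by simp
      then have "r < 1" using r(3) by linarith
      have "w \<le> r powr (1 / \<gamma>)"
        using powr_mono2[of "1 / \<gamma>" "w powr \<gamma>" r] r wg \<gamma> root by simp
      moreover have "0 < r" using r(2) wg by linarith
      moreover from this have "r powr (1 / \<gamma>) \<le> 1" using \<gamma> \<open>r < 1\<close> by (intro powr_le1) auto
      ultimately have "G w \<le> G (r powr (1 / \<gamma>))"
        using mono w by blast
      also have "\<dots> = G 1 * r"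
        using rational' r(1) \<open>0 < r\<close> \<open>r < 1\<close> by simp
      finally have "G w \<le> G 1 * r" .
      then show False using r(3) pos by (simp add: field_simps)
    qed
    show False if "\<not> G 1 * w powr \<gamma> \<le> G w"
    proof -
      \<comment> \<open>The maximum with \<open>0\<close> makes the rational number chosen next positive, whatever the
        sign of \<open>G w\<close>.\<close>
      have "max 0 (G w / G 1) < w powr \<gamma>" using that pos wg by (simp add: field_simps)
      then obtain r where r: "r \<in> \<rat>" "max 0 (G w / G 1) < r" "r < w powr \<gamma>"
        using Rats_dense_in_real by blast
      have "r powr (1 / \<gamma>) \<le> w"
        using powr_mono2[of "1 / \<gamma>" r "w powr \<gamma>"] r wg \<gamma> root by simp
      then have "G 1 * r \<le> G w"
        using mono[of "r powr (1 / \<gamma>)" w] w rational'[of r] r wg by auto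
      then show False using r(2) pos by (simp add: field_simps)
    qed
  qed
  then show ?thesis using \<gamma> p_eq by blast
qed

section \<open>Stable laws\<close>

text \<open>
  With \<open>t = 1 - z\<close>, the coordinate of \<open>z\<close> is at most a constant times \<open>t\<close> by
  Bernoulli's inequality, so that \<open>1 - P(z) \<le> C * t powr \<gamma>\<close>, against the lower bound
  \<open>(1 - pmf X 0) * t\<close>. For \<open>\<gamma> > 1\<close>, division by \<open>t\<close> and \<open>t \<rightarrow> 0\<close> would
  force \<open>pmf X 0 = 1\<close>.
\<close>
lemma pgf_power_law_exponent_le_1:
  assumes "X \<noteq> return_pmf 0" and \<kappa>: "0 \<le> \<kappa>" "\<kappa> < 1" and "0 < lam"
    and pgf: "\<And>z. z \<in> {0..1} \<Longrightarrow> pgf X z = exp (- lam * mobius \<kappa> (z ^ m) powr \<gamma>)"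
  shows "\<gamma> \<le> 1"
proof (rule ccontr)
  assume "\<not> \<gamma> \<le> 1"
  define C where "C = lam * (real m / (1 - \<kappa>)) powr \<gamma>"
  have bound: "1 - pmf X 0 \<le> C * t powr (\<gamma> - 1)" if t: "0 < t" "t < 1" for t
  proof -
    define z where "z = 1 - t"
    have z: "z \<in> {0..1}" using t by (simp add: z_def)
    have "1 - z ^ m \<le> real m * t"
      using Bernoulli_inequality[of "- t" m] t by (simp add: z_def)
    moreover have "1 - \<kappa> \<le> 1 - \<kappa> * z ^ m"
      using \<kappa> power_in_unit[OF z, of m] by (simp add: mult_left_le)
    ultimately have "mobius \<kappa> (z ^ m) \<le> real m * t / (1 - \<kappa>)"
      unfolding mobius_def using \<kappa> power_in_unit[OF z, of m] t by (intro frac_le) auto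
    then have "mobius \<kappa> (z ^ m) powr \<gamma> \<le> (real m / (1 - \<kappa>) * t) powr \<gamma>"
      using mobius_in_unit[OF \<kappa> power_in_unit[OF z], of m] \<open>\<not> \<gamma> \<le> 1\<close> by (intro powr_mono2) auto
    also have "\<dots> = (real m / (1 - \<kappa>)) powr \<gamma> * t powr \<gamma>"
      using powr_mult[of "real m / (1 - \<kappa>)" t \<gamma>] \<kappa> t by simp
    finally have "lam * mobius \<kappa> (z ^ m) powr \<gamma> \<le> C * t powr \<gamma>"
      using \<open>0 < lam\<close> by (simp add: C_def)
    moreover have "1 - lam * mobius \<kappa> (z ^ m) powr \<gamma> \<le> pgf X z"
      using exp_ge_add_one_self[of "- lam * mobius \<kappa> (z ^ m) powr \<gamma>"] pgf[OF z] by simp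
    moreover have "(1 - pmf X 0) * t \<le> 1 - pgf X z"
      using pgf_le_linear[OF z, of X] by (simp add: z_def)
    ultimately have "(1 - pmf X 0) * t \<le> C * t powr \<gamma>" by linarith
    also have "\<dots> = C * t powr (\<gamma> - 1) * t" using t by (simp add: powr_diff)
    finally show ?thesis using t by simp
  qed
  have "((\<lambda>t. C * t powr (\<gamma> - 1)) \<longlongrightarrow> C * 0) (at_right 0)"
    using \<open>\<not> \<gamma> \<le> 1\<close>
    by (intro tendsto_mult tendsto_const tendsto_zero_powrI[where b = "\<gamma> - 1"] tendsto_ident_at)
      (auto intro: eventually_mono[OF eventually_at_right_less])
  moreover have "eventually (\<lambda>t. 1 - pmf X 0 \<le> C * t powr (\<gamma> - 1)) (at_right 0)"
    using eventually_at_right_less[of 0] eventually_at_right_real[of 0 1]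
    by (auto elim!: eventually_mono intro: bound)
  ultimately have "1 - pmf X 0 \<le> C * 0"
    by (intro tendsto_lowerbound[of _ _ "at_right 0"]) auto
  then show False using pmf_0_less_1[OF assms(1)] by simp
qed

text \<open>
  Stability for one \<open>n\<close>, read off in the coordinate \<open>w\<close>, where thinning is
  multiplication by \<open>p\<close>.
\<close>
lemma pgf_thinning_iff:
  assumes q: "mod_geometric \<kappa> m p q"
  shows "X = thinned_sum n X q \<longleftrightarrow>
    (\<forall>w\<in>{0..1}. pgf X (mobius_root \<kappa> m w) = pgf X (mobius_root \<kappa> m (p * w)) ^ n)"
proof
  have par: "0 \<le> \<kappa>" "\<kappa> < 1" "1 \<le> m"
    using q mod_geometric_paramsD by (auto simp: mod_geometric_def)
  have step: "pgf (thinned_sum n X q) z = pgf X (mobius_root \<kappa> m (p * mobius \<kappa> (z ^ m))) ^ n"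
    if z: "z \<in> {0..1}" for z
    using q z par by (simp add: pgf_thinned_sum mod_geometric_def mod_geometric_pgf_eq_mobius_root)
  {
    assume eq: "X = thinned_sum n X q"
    show "\<forall>w\<in>{0..1}. pgf X (mobius_root \<kappa> m w) = pgf X (mobius_root \<kappa> m (p * w)) ^ n"
    proof
      fix w :: real assume w: "w \<in> {0..1}"
      show "pgf X (mobius_root \<kappa> m w) = pgf X (mobius_root \<kappa> m (p * w)) ^ n"
        using step[OF mobius_root_in_unit[OF par(1,2) w, of m], folded eq] w par
        by (simp add: mobius_root_power mobius_involution)
    qed
  next
    assume *: "\<forall>w\<in>{0..1}. pgf X (mobius_root \<kappa> m w) = pgf X (mobius_root \<kappa> m (p * w)) ^ n"
    show "X = thinned_sum n X q"
    proof (rule pgf_inject)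
      fix z :: real assume z: "z \<in> {0..1}"
      show "pgf X z = pgf (thinned_sum n X q) z"
        using *[rule_format, OF mobius_in_unit[OF par(1,2) power_in_unit[OF z]], of m]
          mobius_root_mobius[OF par(1,2) z par(3)] step[OF z] by simp
    qed
  }
qed

text \<open>
  The functional equation alone suffices for stability because a modified geometric law exists
  for every admissible parameter and is determined by its pgf.
\<close>
lemma positive_discrete_stable_mod_geometric_iff:
  "positive_discrete_stable X (mod_geometric \<kappa> m) \<longleftrightarrow>
    (\<exists>p. \<forall>n\<ge>2. mod_geometric_params \<kappa> m (p n) \<and>
      (\<forall>w\<in>{0..1}. pgf X (mobius_root \<kappa> m w) = pgf X (mobius_root \<kappa> m (p n * w)) ^ n))"
  (is "?stable \<longleftrightarrow> (\<exists>p. \<forall>n\<ge>2. ?fe n (p n))")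
proof -
  have "(\<exists>p. 0 < p \<and> p < 1 \<and> (\<exists>q. mod_geometric \<kappa> m p q \<and> X = thinned_sum n X q)) \<longleftrightarrow>
      (\<exists>p. ?fe n p)" for n
  proof (intro ex_cong1 iffI conjI)
    fix p
    assume "0 < p \<and> p < 1 \<and> (\<exists>q. mod_geometric \<kappa> m p q \<and> X = thinned_sum n X q)"
    then obtain q where q: "mod_geometric \<kappa> m p q" "X = thinned_sum n X q" by blast
    from q(1) show "mod_geometric_params \<kappa> m p" by (simp add: mod_geometric_def)
    from pgf_thinning_iff[OF q(1)] q(2)
    show "\<forall>w\<in>{0..1}. pgf X (mobius_root \<kappa> m w) = pgf X (mobius_root \<kappa> m (p * w)) ^ n"
      by blast
  next
    fix p
    assume fe: "?fe n p"
    then show "0 < p" "p < 1" using mod_geometric_paramsD by auto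
    obtain q where q: "mod_geometric \<kappa> m p q" using mod_geometric_law_exists fe by blast
    from pgf_thinning_iff[OF q] q fe
    show "\<exists>q. mod_geometric \<kappa> m p q \<and> X = thinned_sum n X q" by blast
  qed
  then have "?stable \<longleftrightarrow> (\<forall>n\<ge>2. \<exists>p. ?fe n p)"
    unfolding positive_discrete_stable_def by simp
  also have "\<dots> \<longleftrightarrow> (\<exists>p. \<forall>n\<ge>2. ?fe n (p n))" by meson
  finally show ?thesis .
qed

lemma stable_pgf_power_law:
  assumes nondeg: "X \<noteq> return_pmf 0"
    and p: "\<And>n. n \<ge> 2 \<Longrightarrow> mod_geometric_params \<kappa> m (p n)"
    and fe: "\<And>n w. n \<ge> 2 \<Longrightarrow> w \<in> {0..1} \<Longrightarrow>
      pgf X (mobius_root \<kappa> m w) = pgf X (mobius_root \<kappa> m (p n * w)) ^ n"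
  shows "\<exists>\<gamma> lam. 0 < \<gamma> \<and> \<gamma> \<le> 1 \<and> 0 < lam \<and>
    (\<forall>n\<ge>2. p n = real n powr (-1 / \<gamma>)) \<and>
    (\<forall>z\<in>{0..1}. pgf X z = exp (- lam * mobius \<kappa> (z ^ m) powr \<gamma>))"
proof -
  have par: "0 \<le> \<kappa>" "\<kappa> < 1" "1 \<le> m" using mod_geometric_paramsD[OF p[of 2]] by auto
  have p01: "0 < p n \<and> p n < 1" if "n \<ge> 2" for n using mod_geometric_paramsD[OF p[OF that]] by simp
  have unit: "mobius_root \<kappa> m w \<in> {0..1}" if "w \<in> {0..1}" for w
    by (rule mobius_root_in_unit[OF par(1,2) that])
  have pos_inner: "0 < pgf X (mobius_root \<kappa> m w)" if "0 \<le> w" "w < 1" for w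
    using mobius_pos[OF par(1,2) that] unit[of w] that
    by (intro pgf_pos) (auto simp: mobius_root_def)
  \<comment> \<open>At \<open>w = 1\<close>, that is at \<open>z = 0\<close>, a pgf may vanish; here it is the square of its value
    at the interior coordinate \<open>p 2\<close>.\<close>
  have pos: "0 < pgf X (mobius_root \<kappa> m w)" if "w \<in> {0..1}" for w
    using pos_inner[of w] pos_inner[of "p 2"] fe[of 2 1] p01[of 2] that by (cases "w = 1") auto
  define G where "G w = - ln (pgf X (mobius_root \<kappa> m w))" for w
  have pgf_G: "pgf X (mobius_root \<kappa> m w) = exp (- G w)" if "w \<in> {0..1}" for w
    using pos[OF that] by (simp add: G_def)
  have G_mono: "G v \<le> G w" if "0 < v" "v \<le> w" "w \<le> 1" for v w
    using that pos[of v] pos[of w] mobius_root_antimono[OF par(1,2), of v w m] unit[of v] unit[of w]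
    by (simp add: G_def pgf_mono)
  have G_1: "0 < G 1"
  proof -
    have "mobius_root \<kappa> m 1 = 0" by (simp add: mobius_root_def mobius_def)
    then have "pgf X (mobius_root \<kappa> m 1) < 1"
      using pgf_le_linear[of 0 X] pmf_0_less_1[OF nondeg] by simp
    then show ?thesis using pos[of 1] by (simp add: G_def)
  qed
  have G_scale: "G w = real n * G (p n * w)" if "n \<ge> 2" "0 < w" "w \<le> 1" for n w
    using that fe[of n w] p01[of n] pos[of "p n * w"]
    by (simp add: G_def mult_le_one ln_realpow)
  have "\<exists>\<gamma>>0. (\<forall>n\<ge>2. p n = real n powr (-1 / \<gamma>)) \<and>
      (\<forall>w. 0 < w \<longrightarrow> w \<le> 1 \<longrightarrow> G w = G 1 * w powr \<gamma>)"
    using G_mono G_1 p01 G_scale by (rule scaling_power_law)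
  then obtain \<gamma> where \<gamma>: "0 < \<gamma>" and p_eq: "\<And>n. n \<ge> 2 \<Longrightarrow> p n = real n powr (-1 / \<gamma>)"
    and G_eq: "\<And>w. 0 < w \<Longrightarrow> w \<le> 1 \<Longrightarrow> G w = G 1 * w powr \<gamma>"
    by blast
  have pgf_eq: "pgf X z = exp (- G 1 * mobius \<kappa> (z ^ m) powr \<gamma>)" if z: "z \<in> {0..1}" for z
  proof (cases "z = 1")
    case True
    then show ?thesis using \<gamma> by (simp add: pgf_1 mobius_def)
  next
    case False
    then have "z ^ m < 1" using z par(3) by (simp add: power_less_one_iff)
    then have w: "0 < mobius \<kappa> (z ^ m)" "mobius \<kappa> (z ^ m) \<le> 1"
      using mobius_pos[OF par(1,2)] mobius_in_unit[OF par(1,2) power_in_unit[OF z], of m] z by auto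
    then show ?thesis
      using pgf_G[of "mobius \<kappa> (z ^ m)"] G_eq[OF w] mobius_root_mobius[OF par(1,2) z par(3)] by simp
  qed
  show ?thesis
    using \<gamma> pgf_power_law_exponent_le_1[OF nondeg par(1,2) G_1 pgf_eq] G_1 p_eq pgf_eq by blast
qed

theorem theorem3p1:
  fixes X :: "nat pmf" and \<kappa> :: real and m :: nat
  assumes nondegenerate: "X \<noteq> return_pmf 0"
  shows "positive_discrete_stable X (mod_geometric \<kappa> m) \<longleftrightarrow>
    (\<exists>\<gamma> lam. 0 < \<gamma> \<and> \<gamma> \<le> 1 \<and> 0 < lam \<and> 0 \<le> \<kappa> \<and> \<kappa> < 1 \<and> 1 \<le> m \<and>
       (\<forall>n::nat\<ge>2. mod_geometric_params \<kappa> m (real n powr (-1 / \<gamma>))) \<and>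
       (\<forall>z\<in>{0..1}. pgf X z =
          exp (- lam * ((1 - z ^ m) / (1 - \<kappa> * z ^ m)) powr \<gamma>)))"
  (is "_ \<longleftrightarrow> (\<exists>\<gamma> lam. ?law \<gamma> lam)")
proof
  assume "positive_discrete_stable X (mod_geometric \<kappa> m)"
  then obtain p where p: "\<And>n. n \<ge> 2 \<Longrightarrow> mod_geometric_params \<kappa> m (p n)"
    and fe: "\<And>n w. n \<ge> 2 \<Longrightarrow> w \<in> {0..1} \<Longrightarrow>
      pgf X (mobius_root \<kappa> m w) = pgf X (mobius_root \<kappa> m (p n * w)) ^ n"
    unfolding positive_discrete_stable_mod_geometric_iff by blast
  have "\<exists>\<gamma> lam. 0 < \<gamma> \<and> \<gamma> \<le> 1 \<and> 0 < lam \<and>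
      (\<forall>n\<ge>2. p n = real n powr (-1 / \<gamma>)) \<and>
      (\<forall>z\<in>{0..1}. pgf X z = exp (- lam * mobius \<kappa> (z ^ m) powr \<gamma>))"
    using nondegenerate p fe by (rule stable_pgf_power_law)
  then obtain \<gamma> lam where law: "0 < \<gamma>" "\<gamma> \<le> 1" "0 < lam"
    "\<And>n. n \<ge> 2 \<Longrightarrow> p n = real n powr (-1 / \<gamma>)"
    "\<And>z. z \<in> {0..1} \<Longrightarrow> pgf X z = exp (- lam * mobius \<kappa> (z ^ m) powr \<gamma>)"
    by blast
  have "mod_geometric_params \<kappa> m (real n powr (-1 / \<gamma>))" if "n \<ge> 2" for n
    using p[OF that] law(4)[OF that] by simp
  then show "\<exists>\<gamma> lam. ?law \<gamma> lam"
    using law mod_geometric_paramsD[OF p[of 2]] unfolding mobius_def by blast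
next
  assume "\<exists>\<gamma> lam. ?law \<gamma> lam"
  then obtain \<gamma> lam where \<gamma>: "0 < \<gamma>" and par: "0 \<le> \<kappa>" "\<kappa> < 1" "1 \<le> m"
    and p: "\<And>n::nat. n \<ge> 2 \<Longrightarrow> mod_geometric_params \<kappa> m (real n powr (-1 / \<gamma>))"
    and pgf: "\<And>z. z \<in> {0..1} \<Longrightarrow> pgf X z = exp (- lam * mobius \<kappa> (z ^ m) powr \<gamma>)"
    unfolding mobius_def by blast
  have pgf_root: "pgf X (mobius_root \<kappa> m w) = exp (- lam * w powr \<gamma>)" if "w \<in> {0..1}" for w
    using that par pgf[OF mobius_root_in_unit[OF par(1,2) that, of m]]
    by (simp add: mobius_root_power mobius_involution)
  have "pgf X (mobius_root \<kappa> m w) = pgf X (mobius_root \<kappa> m (real n powr (-1 / \<gamma>) * w)) ^ n"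
    if n: "n \<ge> 2" and w: "w \<in> {0..1}" for n :: nat and w
  proof -
    have pn: "0 < real n powr (-1 / \<gamma>)" "real n powr (-1 / \<gamma>) < 1"
      using mod_geometric_paramsD[OF p[OF n]] by auto
    have "(real n powr (-1 / \<gamma>) * w) powr \<gamma> = w powr \<gamma> / real n"
      unfolding powr_mult powr_powr using n \<gamma> by (simp add: powr_minus_divide)
    then show ?thesis
      using pgf_root[OF w] pgf_root[of "real n powr (-1 / \<gamma>) * w"] pn w n
      by (simp add: mult_le_one flip: exp_of_nat_mult)
  qed
  then show "positive_discrete_stable X (mod_geometric \<kappa> m)"
    unfolding positive_discrete_stable_mod_geometric_iff using p
    by (intro exI[of _ "\<lambda>n. real n powr (-1 / \<gamma>)"]) blast
qed

end
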